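(* Let $n \geq k \geq l \geq 0$ be integers and let $X$ be a set with $n$ elements. Let $\mathcal{F}$ be a family of $l$-element subsets of $X$ of smallest possible size such that every $k$-element subset of $X$ contains at least one member of $\mathcal{F}$ as a subset, so that $T(n,k,l) = |\mathcal{F}|$. Then $$T(n,k,l) = |\mathcal{F}| \geq \frac{\binom{n}{l}}{\binom{k}{l}}.$$
   Context: For integers $n \geq k \geq l$, the Turán number $T(n,k,l)$ is the smallest number of $l$-element subsets of an $n$-element set $X$ such that every $k$-element subset of $X$ contains at least one of these $l$-element subsets. *)

theory Defs
  imports Complex_Main "HOL-Library.Ramsey"
begin

text \<open>\<^term>\<open>nsets X l\<close> is the set of all finite subsets of \<^term>\<open>X\<close> with exactly
  \<^term>\<open>l\<close> elements.\<close>

definition turan_system :: "'a set \<Rightarrow> nat \<Rightarrow> nat \<Rightarrow> 'a set set \<Rightarrow> bool" where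
  "turan_system X k l F \<longleftrightarrow>
     F \<subseteq> nsets X l \<and> (\<forall>K \<in> nsets X k. \<exists>S \<in> F. S \<subseteq> K)"

text \<open>The value does not depend on the choice of the \<^term>\<open>n\<close>-element ground set; we fix
  \<^term>\<open>{..<n}\<close>. For \<^prop>\<open>l \<le> k\<close> the set over which the minimum is taken is nonempty,
  since it contains the size of the family of all \<^term>\<open>l\<close>-element subsets.\<close>

definition turan_number :: "nat \<Rightarrow> nat \<Rightarrow> nat \<Rightarrow> nat" where
  "turan_number n k l = (LEAST m. \<exists>F. turan_system {..<n} k l F \<and> card F = m)"

end

theory Submission
  imports Defs
begin

text \<open>Count the pairs of a member \<open>S\<close> of \<open>F\<close> and a \<open>k\<close>-set containing it. Every \<open>k\<close>-set occurs at
  least once, and each \<open>S\<close> lies in exactly \<open>(n - l) choose (k - l)\<close> of them, so that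
  \<open>n choose k \<le> card F * ((n - l) choose (k - l))\<close>. The bound follows from
  \<open>(n choose k) * (k choose l) = (n choose l) * ((n - l) choose (k - l))\<close>.\<close>

text \<open>Such a \<open>K\<close> is determined by \<open>K - S\<close>, which ranges over all
  \<open>(k - l)\<close>-subsets of \<open>X - S\<close>; \<open>U \<mapsto> S \<union> U\<close>
  and \<open>K \<mapsto> K - S\<close> are mutually inverse.\<close>

lemma card_nsets_supersets:
  assumes "finite X" "S \<in> nsets X l" "l \<le> k"
  shows "card {K \<in> nsets X k. S \<subseteq> K} = (card X - l) choose (k - l)"
proof -
  have S: "S \<subseteq> X" "finite S" "card S = l"
    using assms(2) by (auto simp: nsets_def)
  have "bij_betw (\<lambda>U. S \<union> U) (nsets (X - S) (k - l)) {K \<in> nsets X k. S \<subseteq> K}"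
  proof (rule bij_betwI[where g = "\<lambda>K. K - S"])
    show "(\<lambda>U. S \<union> U) \<in> nsets (X - S) (k - l) \<rightarrow> {K \<in> nsets X k. S \<subseteq> K}"
    proof
      fix U assume "U \<in> nsets (X - S) (k - l)"
      then have U: "U \<subseteq> X - S" "finite U" "card U = k - l"
        by (auto simp: nsets_def)
      then have "card (S \<union> U) = card S + card U"
        using S by (intro card_Un_disjoint) auto
      then show "S \<union> U \<in> {K \<in> nsets X k. S \<subseteq> K}"
        using U S assms(3) by (auto simp: nsets_def)
    qed
    show "(\<lambda>K. K - S) \<in> {K \<in> nsets X k. S \<subseteq> K} \<rightarrow> nsets (X - S) (k - l)"
      using S by (auto simp: nsets_def card_Diff_subset)
  qed (auto simp: nsets_def)
  then have "card {K \<in> nsets X k. S \<subseteq> K} = card (nsets (X - S) (k - l))"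
    by (rule bij_betw_same_card[symmetric])
  then show ?thesis
    using S assms(1) by (simp add: card_Diff_subset)
qed

lemma choose_le_card_turan_system:
  assumes "finite X" "l \<le> k" "turan_system X k l F"
  shows "card X choose k \<le> card F * ((card X - l) choose (k - l))"
proof -
  have F: "F \<subseteq> nsets X l" and cover: "\<And>K. K \<in> nsets X k \<Longrightarrow> \<exists>S\<in>F. S \<subseteq> K"
    using assms(3) by (auto simp: turan_system_def)
  \<comment> \<open>Finiteness matters because \<open>card\<close> and sums default to 0 on infinite
    sets.\<close>
  have fin: "finite (nsets X k)" "finite F"
    using assms(1) F by (auto intro: finite_subset finite_imp_finite_nsets)
  have "card X choose k = (\<Sum>K\<in>nsets X k. 1)"
    by simp
  also have "\<dots> \<le> (\<Sum>K\<in>nsets X k. card {S \<in> F. S \<subseteq> K})"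
  proof (rule sum_mono)
    fix K assume "K \<in> nsets X k"
    with cover have "{S \<in> F. S \<subseteq> K} \<noteq> {}" by blast
    then show "1 \<le> card {S \<in> F. S \<subseteq> K}"
      using fin by (simp add: Suc_le_eq card_gt_0_iff)
  qed
  \<comment> \<open>Exchange of summation: the same incidences are now grouped by \<open>S\<close>,
    where each count is constant.\<close>
  also have "\<dots> = (\<Sum>S\<in>F. (card X - l) choose (k - l))"
    using F assms by (intro sum_multicount_gen fin) (auto simp: card_nsets_supersets)
  finally show ?thesis by simp
qed

lemma turan_system_card_bound:
  assumes "finite X" "l \<le> k" "k \<le> card X" "turan_system X k l F"
  shows "real (card X choose l) / real (k choose l) \<le> real (card F)"
proof -
  let ?c = "(card X - l) choose (k - l)"
  have "(card X choose l) * ?c = (card X choose k) * (k choose l)"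
    using assms by (simp add: choose_mult)
  also have "\<dots> \<le> (card F * ?c) * (k choose l)"
    using choose_le_card_turan_system[OF assms(1,2,4)] by (rule mult_le_mono1)
  finally have "(card X choose l) * ?c \<le> (card F * (k choose l)) * ?c"
    by (simp add: ac_simps)
  \<comment> \<open>From \<open>k \<le> card X\<close> follows
    \<open>k - l \<le> card X - l\<close>, so the common factor \<open>?c\<close> is nonzero and
    cancels.\<close>
  moreover have "0 < ?c"
    using assms by (simp add: zero_less_binomial_iff)
  ultimately have "card X choose l \<le> card F * (k choose l)"
    by simp
  then have "real (card X choose l) \<le> real (card F) * real (k choose l)"
    by (metis of_nat_le_iff of_nat_mult)
  moreover have "0 < k choose l"
    using assms(2) by (rule zero_less_binomial)
  ultimately show ?thesis
    by (simp add: divide_le_eq)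
qed

text \<open>Serves to move between an arbitrary ground set and \<open>{..<n}\<close>, on which
  \<open>turan_number\<close> is defined.\<close>

lemma turan_system_bij_image:
  assumes bij: "bij_betw f X Y" and F: "turan_system X k l F"
  shows "turan_system Y k l ((`) f ` F)" and "card ((`) f ` F) = card F"
proof -
  have inj: "inj_on f X" and im: "f ` X = Y"
    using bij by (auto simp: bij_betw_def)
  have sub: "F \<subseteq> nsets X l"
    using F by (simp add: turan_system_def)
  have "inj_on ((`) f) F"
    using inj_on_nsets[OF inj] sub by (rule inj_on_subset)
  then show "card ((`) f ` F) = card F"
    by (rule card_image)
  have "\<exists>S\<in>F. f ` S \<subseteq> K" if K: "K \<in> nsets Y k" for K
  proof -
    let ?g = "inv_into X f"
    \<comment> \<open>\<open>K\<close> is pulled back to \<open>X\<close>, where \<open>F\<close>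
      supplies a member inside it; the image of that member under \<open>f\<close> then lies in
      \<open>K\<close>.\<close>
    have "?g ` K \<in> nsets X k"
      using bij_betw_nsets[OF bij_betw_inv_into[OF bij]] K by (rule bij_betw_apply)
    then obtain S where S: "S \<in> F" "S \<subseteq> ?g ` K"
      using F by (auto simp: turan_system_def)
    have "f ` S \<subseteq> f ` ?g ` K"
      using S(2) by (rule image_mono)
    also have "\<dots> = K"
      using K im by (intro image_inv_into_cancel) (auto simp: nsets_def)
    finally show ?thesis
      using S(1) by blast
  qed
  then show "turan_system Y k l ((`) f ` F)"
    using bij_betw_apply[OF bij_betw_nsets[OF bij]] sub by (auto simp: turan_system_def)
qed

text \<open>Transport along a bijection works both ways: the image of \<open>F\<close> attains the
  value on \<open>{..<n}\<close>, and a smaller system there would pull back to one on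
  \<open>X\<close>, against minimality.\<close>

lemma turan_number_eq_card:
  assumes "finite X" "card X = n" "turan_system X k l F"
    and min: "\<And>G. turan_system X k l G \<Longrightarrow> card F \<le> card G"
  shows "turan_number n k l = card F"
proof -
  obtain f where f: "bij_betw f X {..<n}"
    using assms(1,2) by (metis finite_same_card_bij finite_lessThan card_lessThan)
  show ?thesis
    unfolding turan_number_def
  proof (rule Least_equality)
    show "\<exists>G. turan_system {..<n} k l G \<and> card G = card F"
      using turan_system_bij_image[OF f assms(3)] by blast
  next
    fix m assume "\<exists>G. turan_system {..<n} k l G \<and> card G = m"
    then show "card F \<le> m"
      using turan_system_bij_image[OF bij_betw_inv_into[OF f]] min by metis
  qed
qed

theorem theorem2p2:
  fixes n k l :: nat and X :: "'a set" and F :: "'a set set"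
  assumes "k \<le> n" and "l \<le> k"
    and "finite X" and "card X = n"
    and "turan_system X k l F"
    and "\<And>G. turan_system X k l G \<Longrightarrow> card F \<le> card G"
  shows "turan_number n k l = card F \<and>
    real (card F) \<ge> real (n choose l) / real (k choose l)"
  using turan_number_eq_card[OF assms(3-6)] turan_system_card_bound[of X l k F] assms(1-5)
  by simp

end
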